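(* Assume (AS1): the support set of the uncertainty $\boldsymbol\xi$ is compact and represented by a full-dimensional polytope $\boldsymbol\Xi=\{\boldsymbol\xi\in\mathbb{R}^K:\mathbf{U}\boldsymbol\xi\le\mathbf{t}\}$. Assume also (AS2): the generation recourse actions follow a linear response mechanism that adjusts each dispatchable generator by a fixed percentage of the instantaneous network-wide power imbalance, the latter being equal to $\mathbf{e}^{\mathsf T}\boldsymbol\xi=\xi_1+\dots+\xi_K$, so that the generation adjustment is $\boldsymbol{g}'(\boldsymbol\xi)=\boldsymbol\gamma(\mathbf{e}^{\mathsf T}\boldsymbol\xi)$ with coefficient vector $\boldsymbol\gamma\in\mathbb{R}^N$. Then, for fixed grid topology $\boldsymbol z$ and coefficients $\boldsymbol\gamma$, the adjustments $\boldsymbol\theta'(\boldsymbol\xi)$ on voltage angle and $\boldsymbol f'(\boldsymbol\xi)$ on line flow become exactly linear functions of $\boldsymbol\xi$, i.e. $$\boldsymbol\theta'(\boldsymbol\xi)=\boldsymbol Y_\theta\boldsymbol\xi,\qquad \boldsymbol f'(\boldsymbol\xi)=\boldsymbol Y_f\boldsymbol\xi ,$$ with both matrices $\boldsymbol Y_\theta\in\mathbb{R}^{N\times K}$ and $\boldsymbol Y_f\in\mathbb{R}^{L\times K}$ uniquely determined by $\boldsymbol z$ and $\boldsymbol\gamma$.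
   Context: Setting: two-stage optimal transmission switching under the dc power flow model. The network has buses $\mathcal N=\{1,\dots,N\}$ and lines $\mathcal L=\{(i,j)\}\subset\mathcal N\times\mathcal N$ with $|\mathcal L|=L$. $\mathbf e$ is the all-ones vector (of appropriate dimension) and $\mathbf e_i$ the $i$-th standard basis vector. $\mathbf A\in\mathbb Z^{N\times L}$ is the graph incidence matrix whose column for line $(i,j)$ is $\mathbf e_i-\mathbf e_j$. $b_{ij}$ denotes the inverse of the reactance of line $(i,j)$. The grid topology is a binary vector $\boldsymbol z\in\{0,1\}^L$ of line statuses (1: closed, 0: open). First stage: $\boldsymbol g,\boldsymbol d,\boldsymbol\theta\in\mathbb R^N$ are the nodal generation, load and voltage angles, and $\boldsymbol f\in\mathbb R^L$ the line flows. They satisfy the nodal power balance $\mathbf A\boldsymbol f=\boldsymbol g-\boldsymbol d$, with $f_{ij}=b_{ij}(\theta_i-\theta_j)$ on every closed line and $f_{ij}=0$ on every open line. The response coefficients $\boldsymbol\gamma$ are also first-stage decisions, constrained in the switching problem by $\boldsymbol\gamma\in[0,1]^N$ and $\mathbf e^{\mathsf T}\boldsymbol\gamma=1$. Second stage (recourse): the uncertainty vector $\boldsymbol\xi\in\mathbb R^K$ (e.g. due to renewable generation or flexible demand) is mapped to the buses by a known matrix $\mathbf F\in\mathbb R^{N\times K}$. After $\boldsymbol\xi$ is observed, generation, angles and line flows become $\boldsymbol g+\boldsymbol\gamma\mathbf e^{\mathsf T}\boldsymbol\xi$, $\boldsymbol\theta+\boldsymbol\theta'(\boldsymbol\xi)$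 and $\boldsymbol f+\boldsymbol f'(\boldsymbol\xi)$, where $\boldsymbol\theta':\mathbb R^K\to\mathbb R^N$ and $\boldsymbol f':\mathbb R^K\to\mathbb R^L$ are the adjustments on angle and line flow. For all $\boldsymbol\xi\in\boldsymbol\Xi$ the adjusted quantities satisfy the power balance $\mathbf A(\boldsymbol f+\boldsymbol f'(\boldsymbol\xi))=\boldsymbol g+\boldsymbol\gamma\mathbf e^{\mathsf T}\boldsymbol\xi-\boldsymbol d-\mathbf F\boldsymbol\xi$ and the same dc line-flow relations on closed and open lines as in the first stage.
   Formalization: Two assumptions are added: every connected island of closed lines has one reference bus whose voltage angle is not adjusted (otherwise angles may shift by any function of ξ), and all inverse reactances b_ij are positive (otherwise flows need not be determined). *)

theory Defs
  imports "HOL-Analysis.Analysis"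
begin

text \<open>
  Buses are the elements of a finite type \<open>'n\<close>. The line set, a subset of
  \<open>'n \<times> 'n\<close> with L elements, is enumerated by an injective map
  \<open>ends :: 'l \<Rightarrow> 'n \<times> 'n\<close> on a finite type \<open>'l\<close>, so that vectors of line quantities
  have type \<open>real ^ 'l\<close>.
\<close>

definition incidence :: "('l::finite \<Rightarrow> 'n::finite \<times> 'n) \<Rightarrow> real ^ 'l ^ 'n" where
  "incidence ends = (\<chi> i l. (axis (fst (ends l)) 1 - axis (snd (ends l)) 1) $ i)"

text \<open>
  \<open>b\<close> holds the inverse reactances, \<open>z\<close> the line statuses (1 closed, 0 open) and \<open>p\<close>
  the net nodal injections. Reactances are meant to be positive: with mixed signs
  of \<open>b\<close>, even a connected grid need not determine its flows from \<open>p\<close>.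
\<close>

definition dc_power_flow ::
  "('l::finite \<Rightarrow> 'n::finite \<times> 'n) \<Rightarrow> real ^ 'l \<Rightarrow> real ^ 'l \<Rightarrow>
   real ^ 'n \<Rightarrow> real ^ 'n \<Rightarrow> real ^ 'l \<Rightarrow> bool" where
  "dc_power_flow ends b z p \<theta> f \<longleftrightarrow>
     incidence ends *v f = p \<and>
     (\<forall>l. (z $ l = 1 \<longrightarrow> f $ l = b $ l * (\<theta> $ fst (ends l) - \<theta> $ snd (ends l))) \<and>
          (z $ l = 0 \<longrightarrow> f $ l = 0))"

definition closed_lines :: "('l::finite \<Rightarrow> 'n::finite \<times> 'n) \<Rightarrow> real ^ 'l \<Rightarrow> ('n \<times> 'n) set" where
  "closed_lines ends z = {ends l | l. z $ l = 1}"

text \<open>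
  The dc equations only involve differences of angles across closed lines, so
  they leave one additive constant per connected component (island) of the grid
  of closed lines undetermined. Power system practice removes this freedom by a
  reference bus in every island; a connected grid has a single one.
\<close>

definition reference_buses ::
  "('l::finite \<Rightarrow> 'n::finite \<times> 'n) \<Rightarrow> real ^ 'l \<Rightarrow> 'n set \<Rightarrow> bool" where
  "reference_buses ends z R \<longleftrightarrow>
     (\<forall>i. \<exists>!r. r \<in> R \<and> (r, i) \<in> (closed_lines ends z \<union> (closed_lines ends z)\<inverse>)\<^sup>*)"

definition support_set :: "real ^ 'k::finite ^ 'm::finite \<Rightarrow> real ^ 'm \<Rightarrow> (real ^ 'k) set" where
  "support_set U t = {\<xi>. \<forall>i. (U *v \<xi>) $ i \<le> t $ i}"

definition full_dimensional :: "(real ^ 'k::finite) set \<Rightarrow> bool" where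
  "full_dimensional S \<longleftrightarrow> aff_dim S = int CARD('k)"

definition linear_response ::
  "(real ^ 'k::finite) set \<Rightarrow> real ^ 'n::finite \<Rightarrow> (real ^ 'k \<Rightarrow> real ^ 'n) \<Rightarrow> bool" where
  "linear_response \<Xi> \<gamma> g' \<longleftrightarrow> (\<forall>\<xi>\<in>\<Xi>. g' \<xi> = (\<Sum>k\<in>UNIV. \<xi> $ k) *\<^sub>R \<gamma>)"

text \<open>
  The adjustments are only constrained on the support set \<open>\<Xi>\<close>. The angles of the
  reference buses are not adjusted; their first-stage values are arbitrary.
\<close>

definition recourse ::
  "('l::finite \<Rightarrow> 'n::finite \<times> 'n) \<Rightarrow> real ^ 'l \<Rightarrow> real ^ 'l \<Rightarrow> 'n set \<Rightarrow>
   real ^ 'k::finite ^ 'n \<Rightarrow> (real ^ 'k) set \<Rightarrow>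
   real ^ 'n \<Rightarrow> real ^ 'n \<Rightarrow> real ^ 'n \<Rightarrow> real ^ 'l \<Rightarrow>
   (real ^ 'k \<Rightarrow> real ^ 'n) \<Rightarrow> (real ^ 'k \<Rightarrow> real ^ 'n) \<Rightarrow> (real ^ 'k \<Rightarrow> real ^ 'l) \<Rightarrow> bool" where
  "recourse ends b z R F \<Xi> g d \<theta> f g' \<theta>' f' \<longleftrightarrow>
     (\<forall>\<xi>\<in>\<Xi>. dc_power_flow ends b z (g + g' \<xi> - d - F *v \<xi>) (\<theta> + \<theta>' \<xi>) (f + f' \<xi>) \<and>
            (\<forall>r\<in>R. (\<theta> + \<theta>' \<xi>) $ r = \<theta> $ r))"

end

theory Submission imports Defs
begin

text \<open>
  Pairing the balance equation of a flow without injections with its angles gives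
  \<open>0 = (\<Sum>l closed. b l * (\<theta> i - \<theta> j)\<^sup>2)\<close>. Since \<open>b > 0\<close>, the angles of such a flow are constant on
  every island, so they vanish once the reference angles do. Hence the grounded dc equations have
  at most one solution. The injections for which they are solvable form a subspace; as the support
  set is full-dimensional, it spans the whole space, so solvability on the support set gives
  solvability for every unit vector. The solutions for the unit vectors are the columns of the
  matrices.
\<close>

text \<open>Summation by parts: column \<open>l\<close> of the incidence matrix is the difference of
  two unit vectors, so after the two sums are exchanged, pairing that column with \<theta> leaves
  the angle difference along the line.\<close>

lemma inner_incidence_mult:
  "\<theta> \<bullet> (incidence ends *v f) = (\<Sum>l\<in>UNIV. f $ l * (\<theta> $ fst (ends l) - \<theta> $ snd (ends l)))"
proof -
  have "\<theta> \<bullet> (incidence ends *v f)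
      = (\<Sum>i\<in>UNIV. \<Sum>l\<in>UNIV. \<theta> $ i * (incidence ends $ i $ l * f $ l))"
    by (simp add: inner_vec_def matrix_vector_mult_def sum_distrib_left)
  also have "\<dots> = (\<Sum>l\<in>UNIV. \<Sum>i\<in>UNIV. \<theta> $ i * (incidence ends $ i $ l * f $ l))"
    by (rule sum.swap)
  also have "\<dots> = (\<Sum>l\<in>UNIV. f $ l * (\<theta> \<bullet> (axis (fst (ends l)) 1 - axis (snd (ends l)) 1)))"
    by (simp add: inner_vec_def incidence_def sum_distrib_left mult_ac)
  finally show ?thesis
    by (simp add: inner_diff_right inner_axis)
qed

lemma dc_power_flow_0: "dc_power_flow ends b z 0 0 0"
  by (simp add: dc_power_flow_def)

lemma dc_power_flow_add:
  assumes "dc_power_flow ends b z p \<theta> f" "dc_power_flow ends b z p' \<theta>' f'"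
  shows "dc_power_flow ends b z (p + p') (\<theta> + \<theta>') (f + f')"
  using assms by (auto simp: dc_power_flow_def matrix_vector_right_distrib right_diff_distrib distrib_left)

lemma dc_power_flow_scale:
  assumes "dc_power_flow ends b z p \<theta> f"
  shows "dc_power_flow ends b z (c *\<^sub>R p) (c *\<^sub>R \<theta>) (c *\<^sub>R f)"
  using assms by (auto simp: dc_power_flow_def matrix_vector_mult_scaleR right_diff_distrib mult.left_commute)

lemma dc_power_flow_diff:
  assumes "dc_power_flow ends b z p \<theta> f" "dc_power_flow ends b z p' \<theta>' f'"
  shows "dc_power_flow ends b z (p - p') (\<theta> - \<theta>') (f - f')"
  using dc_power_flow_add[OF assms(1) dc_power_flow_scale[OF assms(2), of "-1"]] by simp

lemma dc_power_flow_sum: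
  assumes "\<And>k. k \<in> A \<Longrightarrow> dc_power_flow ends b z (p k) (\<theta> k) (f k)"
  shows "dc_power_flow ends b z (\<Sum>k\<in>A. p k) (\<Sum>k\<in>A. \<theta> k) (\<Sum>k\<in>A. f k)"
  using assms
  by (induction A rule: infinite_finite_induct) (auto intro: dc_power_flow_0 dc_power_flow_add)

lemma dc_power_flow_0_angles_eq:
  assumes pos: "\<And>l. b $ l > 0" and z: "\<And>l. z $ l \<in> {0, 1}"
    and flow: "dc_power_flow ends b z 0 \<theta> f" and closed: "z $ l = 1"
  shows "\<theta> $ fst (ends l) = \<theta> $ snd (ends l)"
proof -
  define \<delta> where "\<delta> l = \<theta> $ fst (ends l) - \<theta> $ snd (ends l)" for l
  \<comment> \<open>Statuses are binary, so a line is either closed, which gives a square weighted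
    by \<open>b\<close>, or open, which gives no flow at all. Either way the term is
    nonnegative.\<close>
  have f: "f $ l * \<delta> l = (if z $ l = 1 then b $ l * (\<delta> l)\<^sup>2 else 0)" for l
    using flow z[of l] by (auto simp: dc_power_flow_def \<delta>_def power2_eq_square)
  have "(\<Sum>l\<in>UNIV. f $ l * \<delta> l) = \<theta> \<bullet> (incidence ends *v f)"
    by (simp add: inner_incidence_mult \<delta>_def)
  also have "\<dots> = 0"
    using flow by (simp add: dc_power_flow_def)
  finally have "f $ l * \<delta> l = 0"
    using pos by (subst (asm) sum_nonneg_eq_0_iff) (auto simp: f less_imp_le)
  then show ?thesis
    using closed pos[of l] by (simp add: f) (simp add: \<delta>_def)
qed

lemma dc_power_flow_0_unique:
  assumes pos: "\<And>l. b $ l > 0" and z: "\<And>l. z $ l \<in> {0, 1}"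
    and R: "reference_buses ends z R"
    and flow: "dc_power_flow ends b z 0 \<theta> f" and ground: "\<And>r. r \<in> R \<Longrightarrow> \<theta> $ r = 0"
  shows "\<theta> = 0" and "f = 0"
proof -
  \<comment> \<open>Induction along a path of closed lines. The converse relation allows a line to
    be traversed against its orientation, hence the two cases for \<open>ends l\<close>.\<close>
  have eq: "\<theta> $ i = \<theta> $ j" if "(i, j) \<in> (closed_lines ends z \<union> (closed_lines ends z)\<inverse>)\<^sup>*" for i j
    using that
  proof induction
    case (step j k)
    then obtain l where "z $ l = 1" "ends l = (j, k) \<or> ends l = (k, j)"
      by (auto simp: closed_lines_def)
    with step.IH dc_power_flow_0_angles_eq[OF pos z flow, of l] show ?case
      by auto
  qed simp
  show \<theta>: "\<theta> = 0"
  proof (rule vec_eq_iff[THEN iffD2], rule allI)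
    fix i
    obtain r where "r \<in> R" "(r, i) \<in> (closed_lines ends z \<union> (closed_lines ends z)\<inverse>)\<^sup>*"
      using R unfolding reference_buses_def by blast
    with eq ground show "\<theta> $ i = 0 $ i"
      by fastforce
  qed
  have "f $ l = 0" for l
    using flow z[of l] by (auto simp: dc_power_flow_def \<theta>)
  then show "f = 0"
    by (simp add: vec_eq_iff)
qed

text \<open>The difference of two such solutions has zero injections and vanishes at the reference
  buses.\<close>

lemma dc_power_flow_unique:
  assumes "\<And>l. b $ l > 0" and "\<And>l. z $ l \<in> {0, 1}" and "reference_buses ends z R"
    and "dc_power_flow ends b z p \<theta> f" and "dc_power_flow ends b z p \<theta>' f'"
    and "\<And>r. r \<in> R \<Longrightarrow> \<theta> $ r = \<theta>' $ r"
  shows "\<theta> = \<theta>'" and "f = f'"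
  using dc_power_flow_0_unique[of b z ends R "\<theta> - \<theta>'" "f - f'"]
    dc_power_flow_diff[OF assms(4,5)] assms by auto

text \<open>An affine hull of full dimension is the whole space, and it lies inside the linear
  span.\<close>

lemma full_dimensional_span:
  assumes "full_dimensional S"
  shows "span S = UNIV"
proof -
  have "affine hull S = UNIV"
    using assms by (simp add: full_dimensional_def affine_hull_UNIV aff_dim_eq_full)
  then show ?thesis
    using affine_hull_subset_span[of S] by auto
qed

lemma matrix_eq_on_span:
  fixes A B :: "real ^ 'k ^ 'm"
  assumes "span S = UNIV" and "\<And>x. x \<in> S \<Longrightarrow> A *v x = B *v x"
  shows "A = B"
proof -
  have "A *v x = B *v x" for x
    using linear_eq_on_span[of "(*v) A" "(*v) B" S x] assms by simp
  then show ?thesis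
    by (simp add: matrix_eq)
qed

text \<open>
  The matrices are chosen before the adjustments are known, so they may only depend on the
  solvability of the grounded equations for the injections \<open>M *v \<xi>\<close>.
\<close>

lemma grounded_solution_matrices:
  fixes ends :: "'l::finite \<Rightarrow> 'n::finite \<times> 'n" and M :: "real ^ 'k::finite ^ 'n"
  assumes span: "span S = UNIV"
  obtains Y\<^sub>\<theta> :: "real ^ 'k ^ 'n" and Y\<^sub>f :: "real ^ 'k ^ 'l"
    where "\<And>\<xi>. (\<forall>\<eta>\<in>S. \<exists>\<theta> f. dc_power_flow ends b z (M *v \<eta>) \<theta> f \<and> (\<forall>r\<in>R. \<theta> $ r = 0)) \<Longrightarrow>
      dc_power_flow ends b z (M *v \<xi>) (Y\<^sub>\<theta> *v \<xi>) (Y\<^sub>f *v \<xi>) \<and> (\<forall>r\<in>R. (Y\<^sub>\<theta> *v \<xi>) $ r = 0)"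
proof -
  define sol where
    "sol p \<theta> f \<longleftrightarrow> dc_power_flow ends b z p \<theta> f \<and> (\<forall>r\<in>R. \<theta> $ r = 0)" for p \<theta> f
  \<comment> \<open>The choice is total: if the equations for a unit vector have no solution, the
    column is an arbitrary vector, so the matrices can be defined before solvability is known. The
    flows \<open>\<Phi> k\<close> are chosen relative to the angles \<open>\<Theta> k\<close>, so
    that both belong to one solution.\<close>
  define \<Theta> where "\<Theta> k = (SOME \<theta>. \<exists>f. sol (M *v axis k 1) \<theta> f)" for k
  define \<Phi> where "\<Phi> k = (SOME f. sol (M *v axis k 1) (\<Theta> k) f)" for k
  define Y\<^sub>\<theta> :: "real ^ 'k ^ 'n" where "Y\<^sub>\<theta> = (\<chi> i k. \<Theta> k $ i)"
  define Y\<^sub>f :: "real ^ 'k ^ 'l" where "Y\<^sub>f = (\<chi> l k. \<Phi> k $ l)"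
  have "sol (M *v \<xi>) (Y\<^sub>\<theta> *v \<xi>) (Y\<^sub>f *v \<xi>)" if solvable: "\<forall>\<eta>\<in>S. \<exists>\<theta> f. sol (M *v \<eta>) \<theta> f" for \<xi>
  proof -
    \<comment> \<open>The grounded equations are homogeneous and linear, so solutions can be added
      and scaled together with their injections.\<close>
    have "subspace {\<eta>. \<exists>\<theta> f. sol (M *v \<eta>) \<theta> f}"
      unfolding subspace_def
    proof (intro conjI ballI allI)
      show "0 \<in> {\<eta>. \<exists>\<theta> f. sol (M *v \<eta>) \<theta> f}"
        using dc_power_flow_0 by (force simp: sol_def)
    next
      fix x y assume "x \<in> {\<eta>. \<exists>\<theta> f. sol (M *v \<eta>) \<theta> f}" "y \<in> {\<eta>. \<exists>\<theta> f. sol (M *v \<eta>) \<theta> f}"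
      then obtain \<theta> f \<theta>' f' where "sol (M *v x) \<theta> f" "sol (M *v y) \<theta>' f'"
        by auto
      then have "sol (M *v (x + y)) (\<theta> + \<theta>') (f + f')"
        by (auto simp: sol_def matrix_vector_right_distrib dc_power_flow_add)
      then show "x + y \<in> {\<eta>. \<exists>\<theta> f. sol (M *v \<eta>) \<theta> f}"
        by blast
    next
      fix c x assume "x \<in> {\<eta>. \<exists>\<theta> f. sol (M *v \<eta>) \<theta> f}"
      then obtain \<theta> f where "sol (M *v x) \<theta> f"
        by auto
      then have "sol (M *v (c *\<^sub>R x)) (c *\<^sub>R \<theta>) (c *\<^sub>R f)"
        by (auto simp: sol_def matrix_vector_mult_scaleR dc_power_flow_scale)
      then show "c *\<^sub>R x \<in> {\<eta>. \<exists>\<theta> f. sol (M *v \<eta>) \<theta> f}"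
        by blast
    qed
    moreover have "S \<subseteq> {\<eta>. \<exists>\<theta> f. sol (M *v \<eta>) \<theta> f}"
      using solvable by blast
    ultimately have "\<exists>\<theta> f. sol (M *v \<eta>) \<theta> f" for \<eta>
      using span_minimal span by blast
    then have "\<exists>f. sol (M *v axis k 1) (\<Theta> k) f" for k
      unfolding \<Theta>_def by (rule someI_ex)
    then have col: "sol (M *v axis k 1) (\<Theta> k) (\<Phi> k)" for k
      unfolding \<Phi>_def by (rule someI_ex)
    \<comment> \<open>Superposition: injections, angles and flows are all expanded with the same
      coefficients \<open>\<xi> $ k\<close>.\<close>
    have M: "M *v \<xi> = (\<Sum>k\<in>UNIV. \<xi> $ k *\<^sub>R (M *v axis k 1))"
      by (simp add: vec_eq_iff matrix_vector_mult_def axis_def if_distrib mult_ac cong: if_cong)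
    have Y: "Y\<^sub>\<theta> *v \<xi> = (\<Sum>k\<in>UNIV. \<xi> $ k *\<^sub>R \<Theta> k)" "Y\<^sub>f *v \<xi> = (\<Sum>k\<in>UNIV. \<xi> $ k *\<^sub>R \<Phi> k)"
      by (simp_all add: vec_eq_iff Y\<^sub>\<theta>_def Y\<^sub>f_def matrix_vector_mult_def mult_ac)
    show ?thesis
      using col unfolding sol_def M Y
      by (auto intro!: dc_power_flow_sum dc_power_flow_scale)
  qed
  then show thesis
    using that unfolding sol_def by blast
qed

theorem lemma1:
  fixes ends :: "'l::finite \<Rightarrow> 'n::finite \<times> 'n"
    and b z :: "real ^ 'l"
    and R :: "'n set"
    and F :: "real ^ 'k::finite ^ 'n"
    and U :: "real ^ 'k ^ 'm::finite" and t :: "real ^ 'm"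
    and \<Xi> :: "(real ^ 'k) set"
    and \<gamma> :: "real ^ 'n"
  assumes "inj ends"
    and "\<And>l. b $ l > 0"
    and "\<And>l. z $ l \<in> {0, 1}"
    and "reference_buses ends z R"
    and "\<Xi> = support_set U t"
    and "compact \<Xi>" and "polytope \<Xi>" and "full_dimensional \<Xi>"
  shows "\<exists>Y\<^sub>\<theta> :: real ^ 'k ^ 'n. \<exists>Y\<^sub>f :: real ^ 'k ^ 'l.
    \<forall>g d \<theta> f g' \<theta>' f'.
      dc_power_flow ends b z (g - d) \<theta> f \<longrightarrow>
      linear_response \<Xi> \<gamma> g' \<longrightarrow>
      recourse ends b z R F \<Xi> g d \<theta> f g' \<theta>' f' \<longrightarrow>
        (\<forall>\<xi>\<in>\<Xi>. \<theta>' \<xi> = Y\<^sub>\<theta> *v \<xi> \<and> f' \<xi> = Y\<^sub>f *v \<xi>) \<and>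
        (\<forall>W. (\<forall>\<xi>\<in>\<Xi>. \<theta>' \<xi> = W *v \<xi>) \<longrightarrow> W = Y\<^sub>\<theta>) \<and>
        (\<forall>W. (\<forall>\<xi>\<in>\<Xi>. f' \<xi> = W *v \<xi>) \<longrightarrow> W = Y\<^sub>f)"
proof -
  \<comment> \<open>The sensitivity of the net injections to \<xi>: the response \<gamma> multiplied
    by the row vector of ones, minus \<open>F\<close>. It involves no first-stage injections, angles
    or flows.\<close>
  define M :: "real ^ 'k ^ 'n" where "M = (\<chi> i k. \<gamma> $ i - F $ i $ k)"
  have M: "M *v \<xi> = (\<Sum>k\<in>UNIV. \<xi> $ k) *\<^sub>R \<gamma> - F *v \<xi>" for \<xi>
    by (simp add: vec_eq_iff M_def matrix_vector_mult_def sum_subtractf sum_distrib_left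
        algebra_simps)
  have span: "span \<Xi> = UNIV"
    using assms by (simp add: full_dimensional_span)
  obtain Y\<^sub>\<theta> :: "real ^ 'k ^ 'n" and Y\<^sub>f :: "real ^ 'k ^ 'l" where Y:
    "\<And>\<xi>. (\<forall>\<eta>\<in>\<Xi>. \<exists>\<theta> f. dc_power_flow ends b z (M *v \<eta>) \<theta> f \<and> (\<forall>r\<in>R. \<theta> $ r = 0)) \<Longrightarrow>
      dc_power_flow ends b z (M *v \<xi>) (Y\<^sub>\<theta> *v \<xi>) (Y\<^sub>f *v \<xi>) \<and> (\<forall>r\<in>R. (Y\<^sub>\<theta> *v \<xi>) $ r = 0)"
    using grounded_solution_matrices[OF span, of ends b z M R] by blast
  show ?thesis
  proof (intro exI[of _ Y\<^sub>\<theta>] exI[of _ Y\<^sub>f] allI impI)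
    fix g d \<theta> f g' \<theta>' f'
    assume base: "dc_power_flow ends b z (g - d) \<theta> f"
      and response: "linear_response \<Xi> \<gamma> g'"
      and recourse: "recourse ends b z R F \<Xi> g d \<theta> f g' \<theta>' f'"
    \<comment> \<open>Subtracting the first-stage equations cancels \<open>g\<close>,
      \<open>d\<close>, \<open>\<theta>\<close> and \<open>f\<close>, and leaves grounded equations
      with injections \<open>M *v \<xi>\<close>.\<close>
    have adj: "dc_power_flow ends b z (M *v \<xi>) (\<theta>' \<xi>) (f' \<xi>) \<and> (\<forall>r\<in>R. \<theta>' \<xi> $ r = 0)"
      if "\<xi> \<in> \<Xi>" for \<xi>
    proof -
      have "g + g' \<xi> - d - F *v \<xi> - (g - d) = M *v \<xi>"
        using response that by (simp add: linear_response_def M)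
      moreover have "dc_power_flow ends b z (g + g' \<xi> - d - F *v \<xi>) (\<theta> + \<theta>' \<xi>) (f + f' \<xi>)"
        and "\<forall>r\<in>R. (\<theta> + \<theta>' \<xi>) $ r = \<theta> $ r"
        using recourse that by (auto simp: recourse_def)
      ultimately show ?thesis
        using dc_power_flow_diff[OF _ base] by fastforce
    qed
    have linear: "\<theta>' \<xi> = Y\<^sub>\<theta> *v \<xi> \<and> f' \<xi> = Y\<^sub>f *v \<xi>" if "\<xi> \<in> \<Xi>" for \<xi>
    proof -
      \<comment> \<open>The adjustments themselves witness the solvability on the support set that
        the choice of the matrices presupposes.\<close>
      have "dc_power_flow ends b z (M *v \<xi>) (Y\<^sub>\<theta> *v \<xi>) (Y\<^sub>f *v \<xi>)"
        and "\<forall>r\<in>R. (Y\<^sub>\<theta> *v \<xi>) $ r = 0"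
        using Y[of \<xi>] adj by blast+
      then show ?thesis
        using adj[OF that] assms(2-4)
          dc_power_flow_unique[of b z ends R "M *v \<xi>" "\<theta>' \<xi>" "f' \<xi>" "Y\<^sub>\<theta> *v \<xi>" "Y\<^sub>f *v \<xi>"]
        by simp
    qed
    \<comment> \<open>Any \<open>W\<close> representing an adjustment on \<Xi> agrees there with the
      constructed matrix, and \<Xi> spans the space.\<close>
    show "(\<forall>\<xi>\<in>\<Xi>. \<theta>' \<xi> = Y\<^sub>\<theta> *v \<xi> \<and> f' \<xi> = Y\<^sub>f *v \<xi>) \<and>
        (\<forall>W. (\<forall>\<xi>\<in>\<Xi>. \<theta>' \<xi> = W *v \<xi>) \<longrightarrow> W = Y\<^sub>\<theta>) \<and>
        (\<forall>W. (\<forall>\<xi>\<in>\<Xi>. f' \<xi> = W *v \<xi>) \<longrightarrow> W = Y\<^sub>f)"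
      using linear by (auto intro!: matrix_eq_on_span[OF span])
  qed
qed

end
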